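(* Let $R$ be a Prüfer domain that is also a $k$-algebra over an infinite field $k$. Then for any $n\ge 1$, every nilpotent matrix in $\mathrm{M}_n(R)$ is a commutator.
   Context: A Prüfer domain is a (commutative) integral domain in which every (nonzero) finitely generated ideal is invertible. $\mathrm{M}_n(R)$ is the ring of $n\times n$ matrices over $R$. A matrix $C\in \mathrm{M}_n(R)$ is a commutator if there exist $A,B\in \mathrm{M}_n(R)$ with $C=[A,B]:=AB-BA$. *)

theory Defs
  imports
    "HOL-Computational_Algebra.Polynomial_Factorial"
    "Jordan_Normal_Form.Matrix"
begin

text \<open>
  A commutative ring is a type of class \<open>comm_ring_1\<close>.  Its ideals are the submodules of the ring
  seen as a module over itself, and the fractional ideals of a domain are submodules of its
  fraction field; both are expressed with \<^const>\<open>Modules.module.subspace\<close> and \<^const>\<open>Modules.module.span\<close>.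
\<close>

lemma module_mult: "Modules.module ((*) :: 'a::comm_ring_1 \<Rightarrow> 'a \<Rightarrow> 'a)"
  by unfold_locales (simp_all add: algebra_simps)

definition fract_scale :: "'a::idom \<Rightarrow> 'a fract \<Rightarrow> 'a fract" where
  "fract_scale r x = to_fract r * x"

lemma module_fract_scale: "Modules.module (fract_scale :: 'a::idom \<Rightarrow> 'a fract \<Rightarrow> 'a fract)"
  by unfold_locales (simp_all add: fract_scale_def algebra_simps)

definition fin_gen_ideal :: "'a::comm_ring_1 set \<Rightarrow> bool" where
  "fin_gen_ideal I \<longleftrightarrow> (\<exists>S. finite S \<and> I = Modules.module.span (*) S)"

definition fractional_ideal :: "'a::idom fract set \<Rightarrow> bool" where
  "fractional_ideal J \<longleftrightarrow>
     Modules.module.subspace fract_scale J \<and>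
     (\<exists>d. d \<noteq> 0 \<and> (\<forall>x\<in>J. fract_scale d x \<in> range to_fract))"

definition fractional_ideal_mult :: "'a::idom fract set \<Rightarrow> 'a fract set \<Rightarrow> 'a fract set" where
  "fractional_ideal_mult I J = Modules.module.span fract_scale {x * y | x y. x \<in> I \<and> y \<in> J}"

text \<open>The unit of the multiplication of fractional ideals is the ring itself, that is, the image of
  \<^const>\<open>to_fract\<close>.\<close>

definition invertible_ideal :: "'a::idom set \<Rightarrow> bool" where
  "invertible_ideal I \<longleftrightarrow>
     (\<exists>J. fractional_ideal J \<and> fractional_ideal_mult (to_fract ` I) J = range to_fract)"

definition pruefer_domain :: "'a::idom itself \<Rightarrow> bool" where
  "pruefer_domain _ \<longleftrightarrow>
     (\<forall>I :: 'a set. fin_gen_ideal I \<and> I \<noteq> {0} \<longrightarrow> invertible_ideal I)"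

text \<open>Algebras over a field whose underlying ring is commutative; compatibility of the scalar action
  with the right factor follows by commutativity.\<close>

locale commutative_algebra = Vector_Spaces.vector_space scale
  for scale :: "'k::field \<Rightarrow> 'r::comm_ring_1 \<Rightarrow> 'r" +
  assumes scale_mult_left: "scale a (x * y) = scale a x * y"

definition nilpotent_mat :: "'a::semiring_1 mat \<Rightarrow> bool" where
  "nilpotent_mat A \<longleftrightarrow> (\<exists>m. A ^\<^sub>m m = 0\<^sub>m (dim_row A) (dim_row A))"

definition commutator_mat :: "nat \<Rightarrow> 'a::ring_1 mat \<Rightarrow> bool" where
  "commutator_mat n C \<longleftrightarrow>
     (\<exists>A \<in> carrier_mat n n. \<exists>B \<in> carrier_mat n n. C = A * B - B * A)"

end

theory Submission
  imports Defs
begin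

text \<open>
  Over a Pruefer domain the kernel of a matrix is a direct summand, so the kernels of the powers of
  \<open>C\<close> split \<open>R\<^sup>n\<close> into summands for which \<open>C\<close> is strictly block upper triangular, with blocks
  \<open>C\<^sub>i\<^sub>j\<close>, \<open>i < j\<close>. Let \<open>A\<close> act on the \<open>i\<close>-th summand as a scalar \<open>a\<^sub>i\<close>, these being distinct elements
  of \<open>k\<close>; then \<open>C = [A, B]\<close> for the matrix \<open>B\<close> with blocks \<open>C\<^sub>i\<^sub>j / (a\<^sub>i - a\<^sub>j)\<close>.
\<close>

section \<open>Kernels over a Pruefer domain as direct summands\<close>

text \<open>As the ideal \<open>I\<close> generated by the \<open>x i\<close> has an inverse
  \<open>J\<close>, 1 is a sum of products from \<open>I\<close> and \<open>J\<close>; sorting these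
  by generators leaves one coefficient \<open>z i\<close> in \<open>J\<close> for each, and
  \<open>z i * x j\<close> lies in \<open>I * J\<close>, the ring itself. In effect \<open>z\<close>
  splits the surjection from \<open>R^n\<close> onto \<open>I\<close>.\<close>

lemma pruefer_dual_generators:
  fixes x :: "nat \<Rightarrow> 'r::idom"
  assumes "pruefer_domain TYPE('r)" and "k < n" and "x k \<noteq> 0"
  shows "\<exists>z. (\<Sum>i<n. to_fract (x i) * z i) = 1 \<and> (\<forall>i<n. \<forall>j<n. z i * to_fract (x j) \<in> range to_fract)"
proof -
  interpret R: Modules.module "(*) :: 'r \<Rightarrow> 'r \<Rightarrow> 'r" by (rule module_mult)
  interpret K: Modules.module "fract_scale :: 'r \<Rightarrow> 'r fract \<Rightarrow> 'r fract" by (rule module_fract_scale)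
  define I where "I = R.span (x ` {..<n})"
  have gen: "x j \<in> I" if "j < n" for j
    unfolding I_def using that by (intro R.span_base) auto
  have "fin_gen_ideal I" unfolding fin_gen_ideal_def I_def by blast
  moreover have "I \<noteq> {0}" using gen[OF assms(2)] assms(3) by auto
  ultimately have "invertible_ideal I" using assms(1) unfolding pruefer_domain_def by blast
  then obtain J where J: "fractional_ideal J"
    and IJ: "fractional_ideal_mult (to_fract ` I) J = range to_fract"
    unfolding invertible_ideal_def by blast
  have subJ: "K.subspace J" using J unfolding fractional_ideal_def by simp
  \<comment> \<open>One term per generator, all coefficients in \<open>J\<close>: as a submodule
    containing every product from \<open>I\<close> and \<open>J\<close>, \<open>W\<close> contains
    \<open>I * J\<close>, hence 1.\<close>
  define W where "W = {\<Sum>i<n. to_fract (x i) * z i | z. \<forall>i<n. z i \<in> J}"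
  have W: "K.subspace W"
  proof (rule K.subspaceI)
    show "0 \<in> W" unfolding W_def
      using K.subspace_0[OF subJ] by (auto intro!: exI[of _ "\<lambda>_. 0"])
  next
    fix u v assume "u \<in> W" "v \<in> W"
    then obtain y z where "u = (\<Sum>i<n. to_fract (x i) * y i)" "v = (\<Sum>i<n. to_fract (x i) * z i)"
      and yz: "\<forall>i<n. y i \<in> J" "\<forall>i<n. z i \<in> J"
      unfolding W_def by blast
    then have "u + v = (\<Sum>i<n. to_fract (x i) * (y i + z i))"
      by (simp add: distrib_left sum.distrib)
    then show "u + v \<in> W" unfolding W_def
      using yz K.subspace_add[OF subJ] by (auto intro!: exI[of _ "\<lambda>i. y i + z i"])
  next
    fix c u assume "u \<in> W"
    then obtain y where "u = (\<Sum>i<n. to_fract (x i) * y i)" and y: "\<forall>i<n. y i \<in> J"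
      unfolding W_def by blast
    then have "fract_scale c u = (\<Sum>i<n. to_fract (x i) * fract_scale c (y i))"
      by (simp add: fract_scale_def sum_distrib_left mult_ac)
    then show "fract_scale c u \<in> W" unfolding W_def
      using y K.subspace_scale[OF subJ] by (auto intro!: exI[of _ "\<lambda>i. fract_scale c (y i)"])
  qed
  have "to_fract a * y \<in> W" if "a \<in> I" and y: "y \<in> J" for a y
  proof -
    \<comment> \<open>For fixed \<open>y\<close> the \<open>a\<close> with \<open>a * y\<close> in
      \<open>W\<close> form an ideal, so only the generators of \<open>I\<close> need
      checking.\<close>
    have "R.subspace {a. to_fract a * y \<in> W}"
    proof (rule R.subspaceI)
      show "0 \<in> {a. to_fract a * y \<in> W}" using K.subspace_0[OF W] by simp
    next
      fix a b assume "a \<in> {a. to_fract a * y \<in> W}" "b \<in> {a. to_fract a * y \<in> W}"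
      then show "a + b \<in> {a. to_fract a * y \<in> W}"
        using K.subspace_add[OF W] by (simp add: distrib_right)
    next
      fix c a assume "a \<in> {a. to_fract a * y \<in> W}"
      then show "c * a \<in> {a. to_fract a * y \<in> W}"
        using K.subspace_scale[OF W, of "to_fract a * y" c] by (simp add: fract_scale_def mult.assoc)
    qed
    moreover have "x ` {..<n} \<subseteq> {a. to_fract a * y \<in> W}"
    proof clarsimp
      fix i assume i: "i < n"
      have "to_fract (x i) * y = (\<Sum>l<n. to_fract (x l) * (if l = i then y else 0))"
        using i by (simp add: if_distrib cong: if_cong)
      moreover have "\<forall>l<n. (if l = i then y else 0) \<in> J"
        using y K.subspace_0[OF subJ] by simp
      ultimately show "to_fract (x i) * y \<in> W"
        unfolding W_def by (auto intro!: exI[of _ "\<lambda>l. if l = i then y else 0"])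
    qed
    ultimately have "I \<subseteq> {a. to_fract a * y \<in> W}"
      unfolding I_def by (intro R.span_minimal)
    then show ?thesis using that(1) by blast
  qed
  then have "fractional_ideal_mult (to_fract ` I) J \<subseteq> W"
    unfolding fractional_ideal_mult_def by (intro K.span_minimal W) auto
  moreover have "(1 :: 'r fract) \<in> range to_fract" by (metis rangeI to_fract_1)
  ultimately obtain z where z: "(\<Sum>i<n. to_fract (x i) * z i) = 1" "\<forall>i<n. z i \<in> J"
    unfolding IJ W_def by (smt (verit) mem_Collect_eq subsetD)
  have "z i * to_fract (x j) \<in> range to_fract" if "i < n" "j < n" for i j
  proof -
    have "to_fract (x j) * z i \<in> fractional_ideal_mult (to_fract ` I) J"
      unfolding fractional_ideal_mult_def
      using that z(2) gen by (intro K.span_base) blast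
    then show ?thesis unfolding IJ by (simp add: mult.commute)
  qed
  with z(1) show ?thesis by blast
qed

text \<open>The matrix of interest is \<open>1 - E\<close>: the first property puts its columns into
  the kernel of \<open>r\<close>, the second makes it fix that kernel. It exists because the image
  of the linear form \<open>r\<close> is zero or an invertible ideal, so that the form
  splits.\<close>

lemma pruefer_row_projection:
  fixes r :: "'r::idom mat"
  assumes "pruefer_domain TYPE('r)" and r: "r \<in> carrier_mat 1 n"
  shows "\<exists>E \<in> carrier_mat n n. r * E = r \<and>
    (\<forall>X \<in> carrier_mat n n. r * X = 0\<^sub>m 1 n \<longrightarrow> E * X = 0\<^sub>m n n)"
proof (cases "\<exists>k<n. r $$ (0,k) \<noteq> 0")
  case False
  then have "r = 0\<^sub>m 1 n" using r by (intro eq_matI) auto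
  then show ?thesis
    by (intro bexI[of _ "0\<^sub>m n n"]) auto
next
  case True
  \<comment> \<open>\<open>E\<close> is the rank one idempotent with entries \<open>z\<^sub>i r\<^sub>j\<close>, where \<open>z\<close> inverts the ideal generated by \<open>r\<close>.\<close>
  define x where "x j = r $$ (0,j)" for j
  from True obtain z where z1: "(\<Sum>i<n. to_fract (x i) * z i) = 1"
    and "\<forall>i<n. \<forall>j<n. z i * to_fract (x j) \<in> range to_fract"
    using pruefer_dual_generators[OF assms(1), of _ n x] unfolding x_def by blast
  \<comment> \<open>Each \<open>z i\<close> is only a fraction, but its products with the
    \<open>x j\<close> come from the ring; \<open>e\<close> picks their preimages.\<close>
  then have "\<forall>i j. \<exists>e. i < n \<and> j < n \<longrightarrow> to_fract e = z i * to_fract (x j)"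
    by (metis (mono_tags, lifting) image_iff)
  then obtain e where e: "\<And>i j. i < n \<Longrightarrow> j < n \<Longrightarrow> to_fract (e i j) = z i * to_fract (x j)"
    by metis
  have to_fract_sum: "to_fract (\<Sum>i\<in>A. f i) = (\<Sum>i\<in>A. to_fract (f i))"
    for A :: "nat set" and f :: "nat \<Rightarrow> 'r"
    by (induction A rule: infinite_finite_induct) auto
  define E where "E = mat n n (\<lambda>(i,j). e i j)"
  have E: "E \<in> carrier_mat n n" unfolding E_def by simp
  have "r * E = r"
  proof (rule eq_matI)
    fix i j assume "i < dim_row r" "j < dim_col r"
    then have i: "i = 0" and j: "j < n" using r by auto
    \<comment> \<open>The identities for \<open>E\<close> are computed in the fraction field and
      pulled back by injectivity of \<open>to_fract\<close>.\<close>
    have "to_fract ((r * E) $$ (0,j)) = (\<Sum>l<n. to_fract (x l) * (z l * to_fract (x j)))"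
      using r j e by (simp add: E_def scalar_prod_def atLeast0LessThan to_fract_sum x_def)
    also have "\<dots> = (\<Sum>l<n. to_fract (x l) * z l) * to_fract (x j)"
      by (simp add: sum_distrib_right mult.assoc)
    finally show "(r * E) $$ (i,j) = r $$ (i,j)" 
      unfolding z1 mult_1 to_fract_eq_iff by (simp only: i x_def)
  qed (use r in \<open>auto simp: E_def\<close>)
  moreover have "E * X = 0\<^sub>m n n" if X: "X \<in> carrier_mat n n" and rX: "r * X = 0\<^sub>m 1 n" for X
  proof (rule eq_matI)
    fix i j assume "i < dim_row (0\<^sub>m n n :: 'r mat)" "j < dim_col (0\<^sub>m n n :: 'r mat)"
    then have i: "i < n" and j: "j < n" by auto
    have "to_fract ((E * X) $$ (i,j)) = (\<Sum>l<n. z i * to_fract (x l) * to_fract (X $$ (l,j)))"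
      using X i j e by (simp add: E_def scalar_prod_def atLeast0LessThan to_fract_sum)
    also have "\<dots> = z i * to_fract (\<Sum>l<n. x l * X $$ (l,j))"
      by (simp add: to_fract_sum sum_distrib_left mult.assoc)
    also have "(\<Sum>l<n. x l * X $$ (l,j)) = (r * X) $$ (0,j)"
      using X r j by (simp add: scalar_prod_def atLeast0LessThan x_def)
    finally show "(E * X) $$ (i,j) = 0\<^sub>m n n $$ (i,j)" using rX i j by simp
  qed (use X in \<open>auto simp: E_def\<close>)
  ultimately show ?thesis using E by blast
qed

text \<open>Square matrices \<open>X\<close> stand in for vectors, their columns being the kernel
  elements. Idempotence of \<open>P\<close> is the case \<open>X = P\<close>.\<close>

definition kernel_projection :: "nat \<Rightarrow> 'a::ring_1 mat \<Rightarrow> 'a mat \<Rightarrow> bool" where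
  "kernel_projection n N P \<longleftrightarrow> P \<in> carrier_mat n n \<and> N * P = 0\<^sub>m n n \<and>
     (\<forall>X \<in> carrier_mat n n. N * X = 0\<^sub>m n n \<longrightarrow> P * X = X)"

text \<open>The rows are imposed one at a time: if \<open>P\<close> projects onto the common kernel
  of the first \<open>k\<close> rows, the one-row case for \<open>r k * P\<close>, the next row
  restricted to that kernel, gives \<open>E\<close>, and \<open>P * (1 - E)\<close> projects onto
  the smaller kernel.\<close>

lemma pruefer_rows_kernel_projection:
  fixes r :: "nat \<Rightarrow> 'r::idom mat"
  assumes "pruefer_domain TYPE('r)" and r: "\<And>i. r i \<in> carrier_mat 1 n"
  shows "\<exists>P \<in> carrier_mat n n. (\<forall>i<k. r i * P = 0\<^sub>m 1 n) \<and>
    (\<forall>X \<in> carrier_mat n n. (\<forall>i<k. r i * X = 0\<^sub>m 1 n) \<longrightarrow> P * X = X)"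
proof (induction k)
  case 0
  show ?case by (intro bexI[of _ "1\<^sub>m n"]) auto
next
  case (Suc k)
  then obtain P where P: "P \<in> carrier_mat n n"
    and rP: "\<And>i. i < k \<Longrightarrow> r i * P = 0\<^sub>m 1 n"
    and PX: "\<And>X. X \<in> carrier_mat n n \<Longrightarrow> (\<And>i. i < k \<Longrightarrow> r i * X = 0\<^sub>m 1 n) \<Longrightarrow> P * X = X"
    by blast
  have rkP: "r k * P \<in> carrier_mat 1 n" by (rule mult_carrier_mat[OF r P])
  from pruefer_row_projection[OF assms(1) this] obtain E where E: "E \<in> carrier_mat n n"
    and rE: "r k * P * E = r k * P"
    and EX: "\<And>X. X \<in> carrier_mat n n \<Longrightarrow> r k * P * X = 0\<^sub>m 1 n \<Longrightarrow> E * X = 0\<^sub>m n n"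
    by blast
  define P' where "P' = P * (1\<^sub>m n - E)"
  have D: "1\<^sub>m n - E \<in> carrier_mat n n" using E by (rule minus_carrier_mat)
  have P': "P' \<in> carrier_mat n n" unfolding P'_def using P D by simp
  have rP': "r i * P' = 0\<^sub>m 1 n" if "i < Suc k" for i
  proof -
    have eq: "r i * P' = r i * P * (1\<^sub>m n - E)"
      unfolding P'_def using assoc_mult_mat[OF r P D] by simp
    show ?thesis
    proof (cases "i = k")
      case True
      have "r k * P * (1\<^sub>m n - E) = r k * P * 1\<^sub>m n - r k * P * E"
        by (rule mult_minus_distrib_mat[OF rkP one_carrier_mat E])
      then show ?thesis using eq rE right_mult_one_mat[OF rkP] rkP True by simp
    next
      case False
      then have "r i * P = 0\<^sub>m 1 n" using rP that by simp
      then show ?thesis using eq left_mult_zero_mat[OF D] by simp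
    qed
  qed
  have "P' * X = X" if X: "X \<in> carrier_mat n n" and rX: "\<forall>i<Suc k. r i * X = 0\<^sub>m 1 n" for X
  proof -
    have PX': "P * X = X" using PX[OF X] rX by simp
    have "r k * P * X = 0\<^sub>m 1 n" using assoc_mult_mat[OF r P X] PX' rX by simp
    then have EX0: "E * X = 0\<^sub>m n n" using EX[OF X] by simp
    have "(1\<^sub>m n - E) * X = 1\<^sub>m n * X - E * X"
      by (rule minus_mult_distrib_mat[OF one_carrier_mat E X])
    also have "\<dots> = X" unfolding EX0 using X by (intro eq_matI) auto
    finally show ?thesis unfolding P'_def using assoc_mult_mat[OF P D X] PX' by simp
  qed
  with P' rP' show ?case by blast
qed

lemma pruefer_kernel_projection_exists:
  fixes N :: "'r::idom mat"
  assumes "pruefer_domain TYPE('r)" and N: "N \<in> carrier_mat n n"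
  shows "\<exists>P. kernel_projection n N P"
proof -
  define r where "r i = mat 1 n (\<lambda>(_,j). N $$ (i,j))" for i
  have r: "r i \<in> carrier_mat 1 n" for i unfolding r_def by simp
  have iff: "N * X = 0\<^sub>m n n \<longleftrightarrow> (\<forall>i<n. r i * X = 0\<^sub>m 1 n)" if X: "X \<in> carrier_mat n n" for X
  proof -
    have entry: "(r i * X) $$ (0,j) = (N * X) $$ (i,j)" if "i < n" "j < n" for i j
      using that N X by (simp add: r_def scalar_prod_def)
    show ?thesis
    proof
      assume NX: "N * X = 0\<^sub>m n n"
      show "\<forall>i<n. r i * X = 0\<^sub>m 1 n"
      proof (intro allI impI eq_matI)
        fix i a j assume "i < n" "a < dim_row (0\<^sub>m 1 n :: 'r mat)" "j < dim_col (0\<^sub>m 1 n :: 'r mat)"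
        then show "(r i * X) $$ (a,j) = 0\<^sub>m 1 n $$ (a,j)"
          using entry[of i j] by (simp add: NX)
      qed (use r X in auto)
    next
      assume rX: "\<forall>i<n. r i * X = 0\<^sub>m 1 n"
      show "N * X = 0\<^sub>m n n"
      proof (rule eq_matI)
        fix i j assume "i < dim_row (0\<^sub>m n n :: 'r mat)" "j < dim_col (0\<^sub>m n n :: 'r mat)"
        then have "i < n" "j < n" by auto
        then show "(N * X) $$ (i,j) = 0\<^sub>m n n $$ (i,j)"
          using entry[of i j] rX by simp
      qed (use N X in auto)
    qed
  qed
  obtain P where P: "P \<in> carrier_mat n n" "\<forall>i<n. r i * P = 0\<^sub>m 1 n"
    "\<forall>X \<in> carrier_mat n n. (\<forall>i<n. r i * X = 0\<^sub>m 1 n) \<longrightarrow> P * X = X"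
    using pruefer_rows_kernel_projection[where r = r and k = n, OF assms(1) r] by blast
  then have "kernel_projection n N P"
    unfolding kernel_projection_def using iff by blast
  then show ?thesis by blast
qed

section \<open>Extending a commutator along the kernels of powers\<close>

text \<open>
  The induction hypothesis along the kernels of the powers of \<open>C\<close>, where \<open>Q\<close> projects onto such a
  kernel: \<open>C\<close> restricted to the image of \<open>Q\<close> is a commutator \<open>[A, B]\<close>, and \<open>A - a\<close> is right invertible
  there for all but finitely many \<open>a \<in> S\<close>, which allows \<open>A\<close> and \<open>B\<close> to be extended by one summand.
\<close>

definition commutator_on :: "nat \<Rightarrow> 'a::ring_1 set \<Rightarrow> 'a mat \<Rightarrow> 'a mat \<Rightarrow> bool" where
  "commutator_on n S C Q \<longleftrightarrow>
     (\<exists>A \<in> carrier_mat n n. \<exists>B \<in> carrier_mat n n. \<exists>F. finite F \<and>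
        Q * A = A \<and> A * Q = A \<and> Q * B = B \<and> B * Q = B \<and> A * B - B * A = C * Q \<and>
        (\<forall>a \<in> S - F. \<exists>T \<in> carrier_mat n n. Q * T = T \<and> A * T - a \<cdot>\<^sub>m T = Q))"

lemma add_diff_add_mat:
  fixes X :: "'a::ab_group_add mat"
  assumes "X \<in> carrier_mat m n" "Y \<in> carrier_mat m n" "V \<in> carrier_mat m n" "W \<in> carrier_mat m n"
  shows "(X + Y) - (V + W) = (X - V) + (Y - W)"
  using assms by (intro eq_matI) auto

lemma add_smult_diff_smult_mat:
  fixes X :: "'a::comm_ring_1 mat"
  assumes "X \<in> carrier_mat m n" "V \<in> carrier_mat m n" "E \<in> carrier_mat m n"
  shows "(X + d \<cdot>\<^sub>m (a \<cdot>\<^sub>m E)) - b \<cdot>\<^sub>m (V + d \<cdot>\<^sub>m E)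
    = (X - b \<cdot>\<^sub>m V) + ((a - b) * d) \<cdot>\<^sub>m E"
  using assms by (intro eq_matI) (auto simp: algebra_simps)

text \<open>The image of \<open>Q'\<close> is the sum of the images of \<open>Q\<close> and
  \<open>E = Q' - Q\<close>, and \<open>C\<close> maps it into the image of \<open>Q\<close>. Hence
  \<open>C\<close> has a zero lower block row, and the upper right block \<open>C * E\<close> is
  produced by letting \<open>A'\<close> be \<open>A\<close> plus the scalar \<open>a\<close> on the
  new summand and giving \<open>B\<close> an upper right block \<open>U\<close> with
  \<open>(A - a) * U = C * E\<close>.\<close>

lemma commutator_on_step:
  fixes S :: "'a::comm_ring_1 set"
  assumes S: "infinite S" "\<And>a b. a \<in> S \<Longrightarrow> b \<in> S \<Longrightarrow> a \<noteq> b \<Longrightarrow> a - b dvd 1"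
    and C: "C \<in> carrier_mat n n" and Q: "Q \<in> carrier_mat n n" and Q': "Q' \<in> carrier_mat n n"
    and QQ: "Q * Q = Q" and QQ': "Q * Q' = Q" and Q'Q: "Q' * Q = Q" and Q'Q': "Q' * Q' = Q'"
    and QCQ': "Q * (C * Q') = C * Q'"
    and com: "commutator_on n S C Q"
  shows "commutator_on n S C Q'"
proof -
  note assoc = assoc_mult_mat[of _ n n _ n _ n]
  obtain A B F where A: "A \<in> carrier_mat n n" and B: "B \<in> carrier_mat n n" and F: "finite F"
    and QA: "Q * A = A" and AQ: "A * Q = A" and QB: "Q * B = B" and BQ: "B * Q = B"
    and AB: "A * B - B * A = C * Q"
    and res: "\<And>a. a \<in> S - F \<Longrightarrow> \<exists>T \<in> carrier_mat n n. Q * T = T \<and> A * T - a \<cdot>\<^sub>m T = Q"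
    using com unfolding commutator_on_def by blast
  \<comment> \<open>The scalar for the new summand: outside \<open>F\<close>, so that
    \<open>A - a\<close> has a right inverse \<open>T\<close> on the image of
    \<open>Q\<close>.\<close>
  obtain a where a: "a \<in> S - F"
    using S(1) F by (metis Diff_eq_empty_iff equals0I finite_subset)
  obtain T where T: "T \<in> carrier_mat n n" and QT: "Q * T = T" and AT: "A * T - a \<cdot>\<^sub>m T = Q"
    using res[OF a] by blast
  define E where "E = Q' - Q"
  have E: "E \<in> carrier_mat n n" unfolding E_def using Q by (rule minus_carrier_mat)
  have E_left: "E * X = Q' * X - Q * X" if "X \<in> carrier_mat n n" for X
    unfolding E_def by (rule minus_mult_distrib_mat[OF Q' Q that])
  have E_right: "X * E = X * Q' - X * Q" if "X \<in> carrier_mat n n" for X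
    unfolding E_def by (rule mult_minus_distrib_mat[OF that Q' Q])
  have zero: "X - X = 0\<^sub>m n n" if "X \<in> carrier_mat n n" for X :: "'a mat"
    using that by simp
  have Q'_left: "Q' * X = X" if "X \<in> carrier_mat n n" "Q * X = X" for X
    using assoc[OF Q' Q that(1)] by (simp add: that(2) Q'Q)
  have right_Q': "X * Q' = X" if "X \<in> carrier_mat n n" "X * Q = X" for X
    using assoc[OF that(1) Q Q'] by (simp add: that(2) QQ')
  have EX0: "E * X = 0\<^sub>m n n" if "X \<in> carrier_mat n n" "Q * X = X" for X
    using that by (simp add: E_left Q'_left zero)
  have XE0: "X * E = 0\<^sub>m n n" if "X \<in> carrier_mat n n" "X * Q = X" for X
    using that by (simp add: E_right right_Q' zero)
  have EQ: "E * Q = 0\<^sub>m n n" using EX0[OF Q QQ] .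
  have QE: "Q * E = 0\<^sub>m n n" using XE0[OF Q QQ] .
  have EQ': "E * Q' = E" using E_left[OF Q'] Q'Q' QQ' by (simp add: E_def)
  have Q'E: "Q' * E = E" using E_right[OF Q'] Q'Q' Q'Q by (simp add: E_def)
  have EE: "E * E = E" unfolding E_left[OF E] Q'E QE using E by (intro eq_matI) auto
  \<comment> \<open>The solution of \<open>(A - a) * U = C * E\<close>, which exists because
    \<open>C * E\<close> has its columns in the image of \<open>Q\<close>.\<close>
  define U where "U = T * (C * E)"
  have CE: "C * E \<in> carrier_mat n n" using C E by simp
  have U: "U \<in> carrier_mat n n" unfolding U_def using T CE by simp
  have QU: "Q * U = U" unfolding U_def using assoc[OF Q T CE] QT by simp
  have UX: "U * X = T * (C * (E * X))" if "X \<in> carrier_mat n n" for X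
    unfolding U_def using assoc[OF T CE that] assoc[OF C E that] by simp
  have UQ: "U * Q = 0\<^sub>m n n" using UX[OF Q] EQ C T by simp
  have UQ': "U * Q' = U" using UX[OF Q'] EQ' by (simp add: U_def)
  have UE: "U * E = U" using UX[OF E] EE by (simp add: U_def)
  have UA: "U * A = 0\<^sub>m n n" using assoc[OF U Q A] UQ A by (simp add: QA)
  have EU: "E * U = 0\<^sub>m n n" using EX0[OF U QU] .
  have QCE: "Q * (C * E) = C * E"
  proof -
    have "C * E = C * Q' * E" using assoc[OF C Q' E] Q'E by simp
    moreover have "Q * (C * Q' * E) = Q * (C * Q') * E"
      using assoc[OF Q mult_carrier_mat[OF C Q'] E] by simp
    ultimately show ?thesis using QCQ' by simp
  qed
  have AU: "A * U - a \<cdot>\<^sub>m U = C * E"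
  proof -
    have "A * U - a \<cdot>\<^sub>m U = A * T * (C * E) - a \<cdot>\<^sub>m T * (C * E)"
      unfolding U_def using assoc[OF A T CE] mult_smult_assoc_mat[OF T CE] by simp
    also have "\<dots> = (A * T - a \<cdot>\<^sub>m T) * (C * E)"
      using minus_mult_distrib_mat[of "A * T" n n "a \<cdot>\<^sub>m T" "C * E" n] A T CE by simp
    finally show ?thesis by (simp add: AT QCE)
  qed
  have aE: "a \<cdot>\<^sub>m E \<in> carrier_mat n n" using E by simp
  define A' where "A' = A + a \<cdot>\<^sub>m E"
  define B' where "B' = B + U"
  have A': "A' \<in> carrier_mat n n" unfolding A'_def using A aE by simp
  have B': "B' \<in> carrier_mat n n" unfolding B'_def using B U by simp
  have A'_left: "A' * X = A * X + a \<cdot>\<^sub>m (E * X)" if "X \<in> carrier_mat n n" for X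
    unfolding A'_def using add_mult_distrib_mat[OF A aE that] mult_smult_assoc_mat[OF E that] by simp
  have A'_right: "X * A' = X * A + a \<cdot>\<^sub>m (X * E)" if "X \<in> carrier_mat n n" for X
    unfolding A'_def using mult_add_distrib_mat[OF that A aE] mult_smult_distrib[OF that E] by simp
  have Q'A': "Q' * A' = A'" using A'_right[OF Q'] Q'_left[OF A QA] Q'E by (simp add: A'_def)
  have A'Q': "A' * Q' = A'" using A'_left[OF Q'] right_Q'[OF A AQ] EQ' by (simp add: A'_def)
  have Q'B': "Q' * B' = B'" unfolding B'_def
    using mult_add_distrib_mat[OF Q' B U] Q'_left[OF B QB] Q'_left[OF U QU] by simp
  have B'Q': "B' * Q' = B'" unfolding B'_def
    using add_mult_distrib_mat[OF B U Q'] right_Q'[OF B BQ] UQ' by simp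
  have A'B: "A' * B = A * B" using A'_left[OF B] EX0[OF B QB] A B by simp
  have A'U: "A' * U = A * U" using A'_left[OF U] EU A U by simp
  have BA': "B * A' = B * A" using A'_right[OF B] XE0[OF B BQ] A B by simp
  have UA': "U * A' = a \<cdot>\<^sub>m U" using A'_right[OF U] UA UE U by simp
  have "A' * B' - B' * A' = (A * B + A * U) - (B * A + a \<cdot>\<^sub>m U)"
    unfolding B'_def using mult_add_distrib_mat[OF A' B U] add_mult_distrib_mat[OF B U A']
    by (simp add: A'B A'U BA' UA')
  also have "\<dots> = (A * B - B * A) + (A * U - a \<cdot>\<^sub>m U)"
    using mult_carrier_mat[OF A B] mult_carrier_mat[OF A U] mult_carrier_mat[OF B A] U
    by (intro add_diff_add_mat) auto
  also have "\<dots> = C * Q + C * E" by (simp add: AB AU)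
  also have "\<dots> = C * (Q + E)" using mult_add_distrib_mat[OF C Q E] by simp
  also have "Q + E = Q'" unfolding E_def using Q Q' by (intro eq_matI) auto
  finally have comm: "A' * B' - B' * A' = C * Q'" .
  have "\<exists>T' \<in> carrier_mat n n. Q' * T' = T' \<and> A' * T' - b \<cdot>\<^sub>m T' = Q'"
    if b: "b \<in> S - insert a F" for b
  proof -
    from b obtain V where V: "V \<in> carrier_mat n n" and QV: "Q * V = V" and AV: "A * V - b \<cdot>\<^sub>m V = Q"
      using res[of b] by blast
    have "a - b dvd 1" using a b by (intro S(2)) auto
    \<comment> \<open>On the image of \<open>E\<close>, \<open>A' - b\<close> is the scalar
      \<open>a - b\<close>, a unit because \<open>a\<close> has joined the excluded set; so
      \<open>V + d * E\<close> is a right inverse on the whole image of \<open>Q'\<close>.\<close>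
    then obtain d where d: "(a - b) * d = 1" by (metis dvdE)
    have dE: "d \<cdot>\<^sub>m E \<in> carrier_mat n n" using E by simp
    have A'V: "A' * V = A * V" using A'_left[OF V] EX0[OF V QV] A V by simp
    have A'E: "A' * E = a \<cdot>\<^sub>m E" using A'_left[OF E] XE0[OF A AQ] EE E by simp
    have "A' * (V + d \<cdot>\<^sub>m E) - b \<cdot>\<^sub>m (V + d \<cdot>\<^sub>m E)
        = (A * V + d \<cdot>\<^sub>m (a \<cdot>\<^sub>m E)) - b \<cdot>\<^sub>m (V + d \<cdot>\<^sub>m E)"
      using mult_add_distrib_mat[OF A' V dE] mult_smult_distrib[OF A' E] by (simp add: A'V A'E)
    also have "\<dots> = (A * V - b \<cdot>\<^sub>m V) + ((a - b) * d) \<cdot>\<^sub>m E"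
      using mult_carrier_mat[OF A V] V E by (rule add_smult_diff_smult_mat)
    also have "\<dots> = Q'" unfolding d AV E_def using Q Q' by (intro eq_matI) auto
    finally have "A' * (V + d \<cdot>\<^sub>m E) - b \<cdot>\<^sub>m (V + d \<cdot>\<^sub>m E) = Q'" .
    moreover have "Q' * (V + d \<cdot>\<^sub>m E) = V + d \<cdot>\<^sub>m E"
      using mult_add_distrib_mat[OF Q' V dE] mult_smult_distrib[OF Q' E] Q'_left[OF V QV] Q'E by simp
    ultimately show ?thesis using V dE by (metis add_carrier_mat)
  qed
  moreover have "finite (insert a F)" using F by simp
  ultimately show ?thesis
    unfolding commutator_on_def using A' B' Q'A' A'Q' Q'B' B'Q' comm by blast
qed

text \<open>Induction on \<open>i\<close>: \<open>C\<close> maps the kernel of its power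
  \<open>i + 1\<close> into the kernel of its power \<open>i\<close>, as the extension step demands.
  The projection stays arbitrary because the step needs one adapted to the larger kernel.\<close>

lemma commutator_on_kernel_projection:
  fixes S :: "'r::idom set"
  assumes pr: "pruefer_domain TYPE('r)"
    and S: "infinite S" "\<And>a b. a \<in> S \<Longrightarrow> b \<in> S \<Longrightarrow> a \<noteq> b \<Longrightarrow> a - b dvd 1"
    and C: "C \<in> carrier_mat n n"
    and "kernel_projection n (C ^\<^sub>m i) Q"
  shows "commutator_on n S C Q"
  using assms(5)
proof (induction i arbitrary: Q)
  case 0
  then have "Q \<in> carrier_mat n n" "C ^\<^sub>m 0 * Q = 0\<^sub>m n n" unfolding kernel_projection_def by auto
  then have Q: "Q = 0\<^sub>m n n" using C by simp
  show ?case unfolding commutator_on_def Q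
    by (rule bexI[of _ "0\<^sub>m n n"], rule bexI[of _ "0\<^sub>m n n"], rule exI[of _ "{}"])
      (use C in \<open>auto intro!: bexI[of _ "0\<^sub>m n n"]\<close>)
next
  case (Suc i Q')
  note assoc = assoc_mult_mat[of _ n n _ n _ n]
  have Ci: "C ^\<^sub>m i \<in> carrier_mat n n" using C by (rule pow_carrier_mat)
  \<comment> \<open>Powers multiply by \<open>C\<close> on the right, whereas the inclusion of
    kernels needs \<open>C\<close> on the left.\<close>
  have comm: "C ^\<^sub>m i * C = C * C ^\<^sub>m i"
  proof (induction i)
    case (Suc i)
    have "C ^\<^sub>m i \<in> carrier_mat n n" using C by (rule pow_carrier_mat)
    from assoc[OF C this C] show ?case by (simp add: Suc.IH)
  qed (use C in simp)
  from Suc.prems have Q': "Q' \<in> carrier_mat n n" and CQ': "C ^\<^sub>m i * C * Q' = 0\<^sub>m n n"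
    and Q'X: "\<And>X. X \<in> carrier_mat n n \<Longrightarrow> C ^\<^sub>m i * C * X = 0\<^sub>m n n \<Longrightarrow> Q' * X = X"
    unfolding kernel_projection_def by auto
  obtain P where P: "P \<in> carrier_mat n n" and CP: "C ^\<^sub>m i * P = 0\<^sub>m n n"
    and PX: "\<And>X. X \<in> carrier_mat n n \<Longrightarrow> C ^\<^sub>m i * X = 0\<^sub>m n n \<Longrightarrow> P * X = X"
    using pruefer_kernel_projection_exists[OF pr Ci] unfolding kernel_projection_def by blast
  have kernel_mono: "C ^\<^sub>m i * C * X = 0\<^sub>m n n"
    if "X \<in> carrier_mat n n" "C ^\<^sub>m i * X = 0\<^sub>m n n" for X
    using assoc[OF C Ci that(1)] that(2) C by (simp add: comm)
  \<comment> \<open>\<open>P\<close> alone need not satisfy \<open>P * Q' = P\<close>. Composing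
    with the idempotent \<open>Q'\<close> enforces this, and still fixes the kernel of the power
    \<open>i\<close>, on which \<open>Q'\<close> is the identity.\<close>
  define Q where "Q = P * Q'"
  have Q: "Q \<in> carrier_mat n n" unfolding Q_def using P Q' by simp
  have CQ: "C ^\<^sub>m i * Q = 0\<^sub>m n n"
    unfolding Q_def using assoc[OF Ci P Q'] CP Q' by simp
  have QX: "Q * X = X" if "X \<in> carrier_mat n n" "C ^\<^sub>m i * X = 0\<^sub>m n n" for X
    unfolding Q_def using assoc[OF P Q' that(1)] PX[OF that] Q'X[OF that(1) kernel_mono[OF that]]
    by simp
  have Q'Q': "Q' * Q' = Q'" using Q'X[OF Q' CQ'] .
  have "Q * Q' = Q" unfolding Q_def using assoc[OF P Q' Q'] Q'Q' by simp
  moreover have "Q * (C * Q') = C * Q'"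
    using QX[of "C * Q'"] CQ' assoc[OF Ci C Q'] C Q' by simp
  moreover have "commutator_on n S C Q"
    using Suc.IH Q CQ QX unfolding kernel_projection_def by blast
  ultimately show ?case
    using QX[OF Q CQ] Q'X[OF Q kernel_mono[OF Q CQ]] Q'Q'
    by (intro commutator_on_step[OF S C Q Q'])
qed

section \<open>Scalars with unit differences, and the conclusion\<close>

lemma commutative_algebra_unit_differences:
  fixes scale :: "'k::field \<Rightarrow> 'r::idom \<Rightarrow> 'r"
  assumes "infinite (UNIV :: 'k set)" and "commutative_algebra scale"
  shows "\<exists>S :: 'r set. infinite S \<and> (\<forall>a\<in>S. \<forall>b\<in>S. a \<noteq> b \<longrightarrow> a - b dvd 1)"
proof -
  interpret commutative_algebra scale by fact
  have dvd: "scale a 1 - scale b 1 dvd 1" if "a \<noteq> b" for a b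
  proof -
    have "(scale a 1 - scale b 1) * scale (inverse (a - b)) 1
        = scale (a - b) (1 * scale (inverse (a - b)) 1)"
      by (simp only: scale_mult_left scale_left_diff_distrib)
    also have "\<dots> = 1" using that by simp
    finally show ?thesis by (metis dvd_triv_left)
  qed
  \<comment> \<open>Distinct scalars with equal images would make 0 a unit.\<close>
  have "inj (\<lambda>a. scale a (1 :: 'r))" by (rule injI) (use dvd in fastforce)
  then have "infinite (range (\<lambda>a. scale a (1 :: 'r)))"
    using assms(1) by (simp add: finite_image_iff)
  then show ?thesis using dvd by (intro exI[of _ "range (\<lambda>a. scale a (1 :: 'r))"]) auto
qed

theorem theorem2p19:
  fixes scale :: "'k::field \<Rightarrow> 'r::idom \<Rightarrow> 'r"
    and C :: "'r mat"
    and n :: nat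
  assumes "infinite (UNIV :: 'k set)"
    and "commutative_algebra scale"
    and "pruefer_domain TYPE('r)"
    and "n \<ge> 1"
    and "C \<in> carrier_mat n n"
    and "nilpotent_mat C"
  shows "commutator_mat n C"
proof -
  obtain S :: "'r set" where S: "infinite S" "\<And>a b. a \<in> S \<Longrightarrow> b \<in> S \<Longrightarrow> a \<noteq> b \<Longrightarrow> a - b dvd 1"
    using commutative_algebra_unit_differences[OF assms(1,2)] by blast
  obtain m where "C ^\<^sub>m m = 0\<^sub>m n n"
    using assms(5,6) unfolding nilpotent_mat_def by auto
  \<comment> \<open>The kernel of the zero matrix is everything, so the identity projects onto
    it.\<close>
  then have "kernel_projection n (C ^\<^sub>m m) (1\<^sub>m n)"
    unfolding kernel_projection_def by simp
  with S have "commutator_on n S C (1\<^sub>m n)"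
    by (intro commutator_on_kernel_projection[OF assms(3) _ _ assms(5)])
  then obtain A B where "A \<in> carrier_mat n n" "B \<in> carrier_mat n n" "A * B - B * A = C * 1\<^sub>m n"
    unfolding commutator_on_def by blast
  then show ?thesis
    unfolding commutator_mat_def right_mult_one_mat[OF assms(5)] by metis
qed

end
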